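(* For any collection $F:S^*\to\mathbb Q$ supported in cardinality $\ge2$, we have $$(\mathbf 1-F)\circ\mathbf TF=\mathbf TF\circ(\mathbf 1-F)=\mathbf 1.$$
   Context: $S$ is a commutative semigroup (written additively) such that every element of $S$ can be represented as a sum $\alpha_1+\dots+\alpha_n$ ($n\ge1$, $\alpha_i\in S$) in only finitely many ways (e.g. $S=\mathbb N^r\setminus\{0\}$). Put $S^*=\bigsqcup_{n\ge1}S^n$. A collection is a map $F:S^*\to\mathbb Q$; it is supported in cardinality $\ge2$ if $F(\alpha)=0$ for all $\alpha\in S=S^1$. The plethysm of collections $F,G$ is $$(F\circ G)(\alpha)=\sum_{\pi}F(\pi_*\alpha)\prod_{j=1}^mG(\alpha|_{\pi^{-1}(j)}),\qquad\alpha\in S^n,$$ where the sum runs over all $m\ge1$ and all order-preserving surjections $\pi:\{1,\dots,n\}\to\{1,\dots,m\}$, $(\pi_*\alpha)_j=\sum_{i\in\pi^{-1}(j)}\alpha_i$, and $\alpha|_{\pi^{-1}(j)}$ is the restricted tuple. The identity collection $\mathbf 1$ takes value $1$ on $S^1$ and $0$ on $S^n$, $n>1$. Free construction. A plane tree is a finite rooted tree in which the children of each internal (non-leaf) vertex are linearly ordered; this induces a linear order on the leaves. The tree with a single element is the unit tree: its element is a leaf and it has no internal vertices. Let $\mathcal T(n)$ be the set of (isomorphism classes of) plane trees whose leaves are identified with $1<\dots<n$ in order. $V(T)$ is the set of internal vertices of $T$ and $\mathrm{ch}(v)$ the ordered set of children of $v\in V(T)$. For $\alpha\in S^n$, $T\in\mathcal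 T(n)$ and $u\in T$ put $\alpha_u=\sum_i\alpha_i$ over the leaves $i$ that are descendants of (or equal to) $u$, and $\alpha|_{\mathrm{ch}(v)}=(\alpha_u)_{u\in\mathrm{ch}(v)}\in S^*$. For $F$ supported in cardinality $\ge2$ the collection $\mathbf TF$ is $$(\mathbf TF)(\alpha)=\sum_{T\in\mathcal T(n)}\ \prod_{v\in V(T)}F(\alpha|_{\mathrm{ch}(v)}),\qquad\alpha\in S^n,$$ where the sum is finite because trees with an internal vertex having exactly one child contribute zero; the empty product is $1$. *)

theory Defs
  imports Complex_Main "HOL-Library.FuncSet" "HOL-Library.Sublist"
begin

text \<open>
  The semigroup \<open>S\<close> is a type of class \<^class>\<open>ab_semigroup_add\<close>. The disjoint union of the powers
  \<open>S^n\<close>, \<open>n \<ge> 1\<close>, is represented by the nonempty lists over that type; a collection is a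
  function on lists whose value at \<^term>\<open>[]\<close> is meaningless. No definition below applies a collection to
  \<^term>\<open>[]\<close> when evaluated at a nonempty list, and equality of collections means agreement on
  nonempty lists. Indices start at \<open>0\<close>.
\<close>

type_synonym 'a collection = "'a list \<Rightarrow> rat"

definition tuple_sum :: "'a::ab_semigroup_add list \<Rightarrow> 'a" where
  "tuple_sum \<alpha> = foldl (+) (hd \<alpha>) (tl \<alpha>)"

definition supported_ge2 :: "'a collection \<Rightarrow> bool" where
  "supported_ge2 F \<longleftrightarrow> (\<forall>a. F [a] = 0)"

definition id_collection :: "'a collection" where
  "id_collection \<alpha> = (if length \<alpha> = 1 then 1 else 0)"

definition eq_collection :: "'a collection \<Rightarrow> 'a collection \<Rightarrow> bool" where
  "eq_collection F G \<longleftrightarrow> (\<forall>\<alpha>. \<alpha> \<noteq> [] \<longrightarrow> F \<alpha> = G \<alpha>)"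

definition mono_surjections :: "nat \<Rightarrow> nat \<Rightarrow> (nat \<Rightarrow> nat) set" where
  "mono_surjections n m =
     {\<pi> \<in> {..<n} \<rightarrow>\<^sub>E {..<m}. mono_on {..<n} \<pi> \<and> \<pi> ` {..<n} = {..<m}}"

definition fibre :: "'a list \<Rightarrow> (nat \<Rightarrow> nat) \<Rightarrow> nat \<Rightarrow> 'a list" where
  "fibre \<alpha> \<pi> j = nths \<alpha> {i. i < length \<alpha> \<and> \<pi> i = j}"

definition pushforward :: "(nat \<Rightarrow> nat) \<Rightarrow> nat \<Rightarrow> 'a::ab_semigroup_add list \<Rightarrow> 'a list" where
  "pushforward \<pi> m \<alpha> = map (\<lambda>j. tuple_sum (fibre \<alpha> \<pi> j)) [0..<m]"

text \<open>There are no surjections for \<open>m > length \<alpha>\<close>, so the sum over all \<open>m \<ge> 1\<close> stops there.\<close>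

definition plethysm ::
  "'a::ab_semigroup_add collection \<Rightarrow> 'a collection \<Rightarrow> 'a collection" where
  "plethysm F G \<alpha> =
     (\<Sum>m = 1..length \<alpha>. \<Sum>\<pi>\<in>mono_surjections (length \<alpha>) m.
        F (pushforward \<pi> m \<alpha>) * (\<Prod>j<m. G (fibre \<alpha> \<pi> j)))"

text \<open>
  Isomorphism classes of plane trees: a tree is the list of the subtrees at the children of its
  root. A leaf is a vertex without children, so \<open>Vertex []\<close> is the unit tree. A vertex is addressed
  by the path leading to it from the root; descent is the prefix order on paths.
\<close>

datatype plane_tree = Vertex (children: "plane_tree list")

lemma size_nth_plane_tree [termination_simp]:
  "i < length ts \<Longrightarrow> size (ts ! i) < Suc (size_list size (ts :: plane_tree list))"
  by (simp add: less_Suc_eq_le size_list_estimation'[OF nth_mem order_refl])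

fun subtree :: "plane_tree \<Rightarrow> nat list \<Rightarrow> plane_tree" where
  "subtree T [] = T"
| "subtree T (i # p) = subtree (children T ! i) p"

fun vertices :: "plane_tree \<Rightarrow> nat list set" where
  "vertices (Vertex ts) = insert [] (\<Union>i\<in>{..<length ts}. (#) i ` vertices (ts ! i))"

definition internal :: "plane_tree \<Rightarrow> nat list set" where
  "internal T = {v \<in> vertices T. children (subtree T v) \<noteq> []}"

text \<open>The leaves listed from left to right.\<close>

fun leaves :: "plane_tree \<Rightarrow> nat list list" where
  "leaves (Vertex ts) =
     (if ts = [] then [[]]
      else concat (map (\<lambda>i. map ((#) i) (leaves (ts ! i))) [0..<length ts]))"

definition ch :: "plane_tree \<Rightarrow> nat list \<Rightarrow> nat list list" where
  "ch T v = map (\<lambda>i. v @ [i]) [0..<length (children (subtree T v))]"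

definition trees :: "nat \<Rightarrow> plane_tree set" where
  "trees n = {T. length (leaves T) = n}"

definition vertex_sum :: "'a::ab_semigroup_add list \<Rightarrow> plane_tree \<Rightarrow> nat list \<Rightarrow> 'a" where
  "vertex_sum \<alpha> T u = tuple_sum (nths \<alpha> {i. i < length (leaves T) \<and> prefix u (leaves T ! i)})"

definition tree_weight :: "'a::ab_semigroup_add collection \<Rightarrow> 'a list \<Rightarrow> plane_tree \<Rightarrow> rat" where
  "tree_weight F \<alpha> T = (\<Prod>v\<in>internal T. F (map (vertex_sum \<alpha> T) (ch T v)))"

text \<open>
  The set \<open>trees n\<close> is infinite for \<open>n \<ge> 1\<close>, because of vertices with exactly one child, and \<^const>\<open>sum\<close>
  vanishes on infinite sets. Hence the sum is taken over the trees that contribute; they are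
  finite in number if \<open>F\<close> is supported in cardinality at least \<open>2\<close>, see
  \<open>finite_contributing_trees\<close>.
\<close>

definition tree_collection :: "'a::ab_semigroup_add collection \<Rightarrow> 'a collection" where
  "tree_collection F \<alpha> =
     (\<Sum>T\<in>{T \<in> trees (length \<alpha>). tree_weight F \<alpha> T \<noteq> 0}. tree_weight F \<alpha> T)"

lemma finite_vertices: "finite (vertices T)"
  by (induction T rule: vertices.induct) auto

lemma finite_internal: "finite (internal T)"
  unfolding internal_def using finite_vertices by simp

lemma length_leaves_Vertex:
  "ts \<noteq> [] \<Longrightarrow> length (leaves (Vertex ts)) = (\<Sum>i<length ts. length (leaves (ts ! i)))"
  by (simp add: length_concat o_def interv_sum_list_conv_sum_set_nat atLeast0LessThan)

lemma length_leaves_pos: "length (leaves T) > 0"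
proof (induction T rule: leaves.induct)
  case (1 ts)
  show ?case
  proof (cases "ts = []")
    case False
    then have "length (leaves (ts ! 0)) > 0" using 1 by simp
    then have "(\<Sum>i<length ts. length (leaves (ts ! i))) > 0"
      using False by (intro sum_pos2[of _ 0]) auto
    then show ?thesis using length_leaves_Vertex[OF False] by simp
  qed simp
qed

definition no_unary :: "plane_tree \<Rightarrow> bool" where
  "no_unary T \<longleftrightarrow> (\<forall>v\<in>vertices T. length (children (subtree T v)) \<noteq> 1)"

lemma no_unary_Vertex:
  "no_unary (Vertex ts) \<longleftrightarrow> length ts \<noteq> 1 \<and> (\<forall>t\<in>set ts. no_unary t)"
  unfolding no_unary_def by (fastforce simp: in_set_conv_nth)

lemma finite_no_unary: "finite {T \<in> trees n. no_unary T}"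
proof (induction n rule: less_induct)
  case (less n)
  let ?A = "\<Union>k<n. {T \<in> trees k. no_unary T}"
  have "T \<in> insert (Vertex []) (Vertex ` {ts. set ts \<subseteq> ?A \<and> length ts \<le> n})"
    if T: "T \<in> trees n" "no_unary T" for T
  proof (cases T)
    case (Vertex ts)
    show ?thesis
    proof (cases "ts = []")
      case False
      have n: "n = (\<Sum>i<length ts. length (leaves (ts ! i)))"
        using T(1) length_leaves_Vertex[OF False] unfolding trees_def Vertex by simp
      have len: "length ts \<ge> 2"
        using T(2) False unfolding Vertex no_unary_Vertex
        by (metis One_nat_def Suc_leI le_neq_implies_less length_0_conv neq0_conv numeral_2_eq_2)
      have "(\<Sum>i<length ts. 1) \<le> n"
        unfolding n using length_leaves_pos by (intro sum_mono) (metis One_nat_def Suc_leI)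
      then have 1: "length ts \<le> n" by simp
      have "length (leaves (ts ! i)) < n" if i: "i < length ts" for i
      proof -
        define j where "j = (if i = 0 then 1 else 0 :: nat)"
        have j: "j < length ts" "j \<noteq> i" using len by (auto simp: j_def)
        have "(\<Sum>k\<in>{i, j}. length (leaves (ts ! k))) \<le> n"
          unfolding n using i j by (intro sum_mono2) auto
        then have "length (leaves (ts ! i)) + length (leaves (ts ! j)) \<le> n" using j by simp
        then show ?thesis using length_leaves_pos[of "ts ! j"] by linarith
      qed
      moreover have "no_unary t" if "t \<in> set ts" for t
        using T(2) that unfolding Vertex no_unary_Vertex by blast
      ultimately have "t \<in> ?A" if "t \<in> set ts" for t
        using that unfolding trees_def in_set_conv_nth by blast
      then have "set ts \<subseteq> ?A" by (rule subsetI)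
      with 1 show ?thesis unfolding Vertex by blast
    qed (simp add: Vertex)
  qed
  then have "{T \<in> trees n. no_unary T} \<subseteq> insert (Vertex []) (Vertex ` {ts. set ts \<subseteq> ?A \<and> length ts \<le> n})"
    by (intro subsetI) (simp only: mem_Collect_eq)
  moreover have "finite (insert (Vertex []) (Vertex ` {ts. set ts \<subseteq> ?A \<and> length ts \<le> n}))"
    using less by (intro finite.insertI finite_imageI finite_lists_length_le) auto
  ultimately show ?case by (rule finite_subset)
qed

lemma tree_weight_unary:
  assumes "supported_ge2 F" "\<not> no_unary T"
  shows "tree_weight F \<alpha> T = 0"
proof -
  obtain v where v: "v \<in> vertices T" "length (children (subtree T v)) = 1"
    using assms(2) unfolding no_unary_def by blast
  then have "v \<in> internal T" unfolding internal_def by auto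
  moreover have "F (map (vertex_sum \<alpha> T) (ch T v)) = 0"
    using assms(1) v(2) unfolding supported_ge2_def ch_def by simp
  ultimately show ?thesis
    unfolding tree_weight_def by (intro prod_zero[OF finite_internal] bexI)
qed

lemma finite_contributing_trees:
  assumes "supported_ge2 F"
  shows "finite {T \<in> trees n. tree_weight F \<alpha> T \<noteq> 0}"
proof (rule finite_subset)
  show "{T \<in> trees n. tree_weight F \<alpha> T \<noteq> 0} \<subseteq> {T \<in> trees n. no_unary T}"
    using tree_weight_unary[OF assms] by auto
qed (rule finite_no_unary)

end

theory Submission imports Defs begin

text \<open>
  Every plane tree other than the unit tree is a root together with the list of its branches, and the
  weight of the tree is the factor at the root times the weights of the branches
  (\<open>tree_weight_Vertex\<close>). Summing over all trees gives the fixed point equation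
  \<open>TF = 1 + F \<circ> TF\<close> (\<open>tree_collection_fixpoint\<close>). Since plethysm is linear in its left argument, this
  says \<open>(1 - F) \<circ> TF = 1\<close>.

  Plethysm is not linear on the right, and \<open>TF \<circ> (1 - F) = 1\<close> is obtained from the monoid structure
  instead: plethysm is associative with unit \<open>1\<close> (\<open>plethysm_assoc\<close>, \<open>plethysm_id_left\<close>,
  \<open>plethysm_id_right\<close>). By the first identity every collection with value \<open>1\<close> on singletons
  has a right inverse. Now \<open>TF\<close> has this property too, so \<open>TF\<close> has both the left inverse \<open>1 - F\<close>
  and some right inverse, and these must agree.

  The combinatorics takes place on lists: order-preserving surjections are replaced by splittings of the
  tuple into consecutive nonempty blocks (\<open>plethysm_splittings\<close>), and products of sums are expanded by
  a single distributive law (\<open>sum_choices\<close>).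
\<close>

section \<open>Plethysm as a sum over splittings\<close>

text \<open>
  An order-preserving surjection \<open>\<pi>\<close> carries the same information as the list of its fibres, that is, as
  a way of cutting \<open>\<alpha>\<close> into consecutive nonempty blocks. Lists of blocks can be nested and
  concatenated, which makes composition of plethysms a matter of list algebra.
\<close>

definition splittings :: "'a list \<Rightarrow> 'a list list set" where
  "splittings \<alpha> = {bs. concat bs = \<alpha> \<and> [] \<notin> set bs}"

lemma splittings_nonempty: "bs \<in> splittings \<alpha> \<Longrightarrow> \<alpha> \<noteq> [] \<Longrightarrow> bs \<noteq> []"
  by (auto simp: splittings_def)

lemma length_le_length_concat: "[] \<notin> set bs \<Longrightarrow> length bs \<le> length (concat bs)"
proof (induction bs)
  case (Cons b bs)
  then show ?case by (cases b) auto
qed simp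

lemma finite_splittings: "finite (splittings \<alpha>)"
proof (rule finite_subset)
  let ?B = "{b. set b \<subseteq> set \<alpha> \<and> length b \<le> length \<alpha>}"
  show "splittings \<alpha> \<subseteq> {bs. set bs \<subseteq> ?B \<and> length bs \<le> length \<alpha>}"
  proof
    fix bs assume bs: "bs \<in> splittings \<alpha>"
    have "set b \<subseteq> set \<alpha> \<and> length b \<le> length \<alpha>" if b: "b \<in> set bs" for b
    proof -
      obtain us vs where "bs = us @ b # vs" using split_list[OF b] by blast
      then show ?thesis using bs by (auto simp: splittings_def)
    qed
    then show "bs \<in> {bs. set bs \<subseteq> ?B \<and> length bs \<le> length \<alpha>}"
      using bs length_le_length_concat[of bs] by (auto simp: splittings_def)
  qed
  show "finite {bs. set bs \<subseteq> ?B \<and> length bs \<le> length \<alpha>}"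
    by (intro finite_lists_length_le) auto
qed

lemma nths_eq_filter_zip:
  assumes "length xs = length \<alpha>"
  shows "nths \<alpha> {i. i < length \<alpha> \<and> P (xs ! i)} = map fst (filter (P \<circ> snd) (zip \<alpha> xs))"
proof -
  have "filter (\<lambda>p. snd p \<in> {i. i < length \<alpha> \<and> P (xs ! i)}) (zip \<alpha> [0..<length \<alpha>])
      = filter (\<lambda>p. P (xs ! snd p)) (zip \<alpha> [0..<length \<alpha>])"
    by (intro filter_cong) (auto simp: set_zip)
  moreover have "zip \<alpha> xs = map (\<lambda>p. (fst p, xs ! snd p)) (zip \<alpha> [0..<length \<alpha>])"
    using assms by (intro nth_equalityI) auto
  ultimately show ?thesis
    by (simp add: nths_def filter_map o_def)
qed

text \<open>
  If the entries of \<open>ls\<close> selected by \<open>P\<close> all lie in one block, then the positions they single out lie in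
  the corresponding block of \<open>bs\<close>. This is used for the fibres of a surjection, with constant blocks
  of values, and for the leaves below a vertex, which all belong to one branch at the root.
\<close>

lemma filter_zip_concat_block:
  assumes len: "length bs = length ls" "\<And>j. j < length ls \<Longrightarrow> length (bs ! j) = length (ls ! j)"
    and i: "i < length ls"
    and P: "\<And>j l. j < length ls \<Longrightarrow> j \<noteq> i \<Longrightarrow> l \<in> set (ls ! j) \<Longrightarrow> \<not> P l"
  shows "filter (P \<circ> snd) (zip (concat bs) (concat ls)) = filter (P \<circ> snd) (zip (bs ! i) (ls ! i))"
proof -
  have "filter (P \<circ> snd) (zip (concat bs) (concat ls))
      = concat (map (filter (P \<circ> snd)) (map2 zip bs ls))"
  proof -
    have "list_all2 (\<lambda>b l. length b = length l) bs ls"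
      using len by (simp add: list_all2_conv_all_nth)
    then show ?thesis by (induction) auto
  qed
  also have "\<dots> = concat (map (\<lambda>j. if j = i then filter (P \<circ> snd) (zip (bs ! i) (ls ! i)) else []) [0..<length ls])"
  proof (rule arg_cong[where f = concat], rule nth_equalityI)
    fix j assume "j < length (map (filter (P \<circ> snd)) (map2 zip bs ls))"
    then have j: "j < length ls" using len by simp
    have "filter (P \<circ> snd) (zip (bs ! j) (ls ! j)) = []" if "j \<noteq> i"
      using P[OF j that] by (auto simp: filter_empty_conv dest: set_zip_rightD)
    then show "map (filter (P \<circ> snd)) (map2 zip bs ls) ! j
      = map (\<lambda>j. if j = i then filter (P \<circ> snd) (zip (bs ! i) (ls ! i)) else []) [0..<length ls] ! j"
      using j len by simp
  qed (use len in simp)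
  also have "\<dots> = filter (P \<circ> snd) (zip (bs ! i) (ls ! i))"
  proof -
    have upt: "[0..<length ls] = [0..<i] @ i # [Suc i..<length ls]"
      using i upt_add_eq_append[of 0 i "length ls - i"] upt_conv_Cons[of i "length ls"] by simp
    have nil: "concat (map (\<lambda>j. if j = i then filter (P \<circ> snd) (zip (bs ! i) (ls ! i)) else []) ks) = []"
      if "i \<notin> set ks" for ks
      using that by (auto simp: concat_eq_Nil_conv)
    show ?thesis unfolding upt map_append concat_append list.map concat.simps by (simp add: nil)
  qed
  finally show ?thesis .
qed

text \<open>
  In a list sorted by \<open>key\<close>, equal keys are adjacent, so collecting the entries key by key keeps their
  order.
\<close>

lemma concat_filter_eq_sorted:
  assumes "sorted (map key ps)"
  shows "concat (map (\<lambda>j. filter (\<lambda>p. key p = j) ps) [0..<m]) = filter (\<lambda>p. key p < m) ps"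
proof (induction m)
  case (Suc m)
  have "filter (\<lambda>p. key p < m) ps @ filter (\<lambda>p. key p = m) ps = filter (\<lambda>p. key p < Suc m) ps"
    using assms
  proof (induction ps)
    case (Cons p ps)
    have "filter (\<lambda>q. key q < m) ps = []" if "\<not> key p < m"
      using Cons.prems that by (auto simp: filter_empty_conv)
    with Cons show ?case by (auto simp: less_Suc_eq)
  qed simp
  with Suc show ?case by simp
qed simp

definition value_list :: "nat \<Rightarrow> (nat \<Rightarrow> nat) \<Rightarrow> nat list" where
  "value_list n \<pi> = map \<pi> [0..<n]"

lemma fibre_eq_filter_zip:
  "fibre \<alpha> \<pi> j = map fst (filter ((\<lambda>k. k = j) \<circ> snd) (zip \<alpha> (value_list (length \<alpha>) \<pi>)))"
proof -
  have "{i. i < length \<alpha> \<and> \<pi> i = j} = {i. i < length \<alpha> \<and> value_list (length \<alpha>) \<pi> ! i = j}"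
    by (auto simp: value_list_def)
  then show ?thesis
    unfolding fibre_def using nths_eq_filter_zip[of "value_list (length \<alpha>) \<pi>" \<alpha> "\<lambda>k. k = j"]
    by (simp add: value_list_def)
qed

lemma mono_surjections_value_list:
  assumes "\<pi> \<in> mono_surjections n m"
  shows "sorted (value_list n \<pi>)" "set (value_list n \<pi>) = {..<m}"
  using assms
  by (auto simp: mono_surjections_def value_list_def sorted_iff_nth_mono mono_on_def atLeast0LessThan)

text \<open>
  Monotonicity makes the fibres consecutive intervals.
\<close>

lemma concat_fibres:
  assumes "\<pi> \<in> mono_surjections (length \<alpha>) m"
  shows "concat (map (fibre \<alpha> \<pi>) [0..<m]) = \<alpha>"
proof -
  let ?z = "zip \<alpha> (value_list (length \<alpha>) \<pi>)"
  have len: "length (value_list (length \<alpha>) \<pi>) = length \<alpha>" by (simp add: value_list_def)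
  have "concat (map (fibre \<alpha> \<pi>) [0..<m])
      = map fst (concat (map (\<lambda>j. filter (\<lambda>p. snd p = j) ?z) [0..<m]))"
    unfolding fibre_eq_filter_zip[abs_def] by (simp add: map_concat o_def)
  also have "\<dots> = map fst (filter (\<lambda>p. snd p < m) ?z)"
    using mono_surjections_value_list(1)[OF assms] len by (subst concat_filter_eq_sorted[of snd]) simp_all
  also have "filter (\<lambda>p. snd p < m) ?z = ?z"
  proof (rule filter_True, rule ballI)
    fix p assume "p \<in> set ?z"
    then have "snd p \<in> set (value_list (length \<alpha>) \<pi>)" by (metis prod.collapse set_zip_rightD)
    then show "snd p < m" unfolding mono_surjections_value_list(2)[OF assms] by simp
  qed
  finally show ?thesis using len by simp
qed

lemma length_fibre:
  "length (fibre \<alpha> \<pi> j) = length (filter (\<lambda>k. k = j) (value_list (length \<alpha>) \<pi>))"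
proof -
  have "value_list (length \<alpha>) \<pi> = map snd (zip \<alpha> (value_list (length \<alpha>) \<pi>))"
    by (simp add: value_list_def)
  then have "filter (\<lambda>k. k = j) (value_list (length \<alpha>) \<pi>)
      = map snd (filter ((\<lambda>k. k = j) \<circ> snd) (zip \<alpha> (value_list (length \<alpha>) \<pi>)))"
    using filter_map[of "\<lambda>k. k = j" snd "zip \<alpha> (value_list (length \<alpha>) \<pi>)"] by simp
  then show ?thesis by (simp add: fibre_eq_filter_zip)
qed

text \<open>
  A monotone surjection is determined by the sizes of its fibres; hence the passage from surjections to
  splittings is injective.
\<close>

lemma value_list_eq_concat_replicate:
  assumes "\<pi> \<in> mono_surjections (length \<alpha>) m"
  shows "value_list (length \<alpha>) \<pi> = concat (map (\<lambda>j. replicate (length (fibre \<alpha> \<pi> j)) j) [0..<m])"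
proof -
  let ?L = "value_list (length \<alpha>) \<pi>"
  have "?L = filter (\<lambda>k. k < m) ?L"
    using mono_surjections_value_list(2)[OF assms] by (auto simp: filter_id_conv)
  also have "\<dots> = concat (map (\<lambda>j. filter (\<lambda>k. k = j) ?L) [0..<m])"
    using concat_filter_eq_sorted[of id ?L m] mono_surjections_value_list(1)[OF assms] by simp
  also have "(\<lambda>j. filter (\<lambda>k. k = j) ?L) = (\<lambda>j. replicate (length (fibre \<alpha> \<pi> j)) j)"
  proof
    fix j :: nat
    have "(\<lambda>k. k = j) = (=) j" by auto
    then show "filter (\<lambda>k. k = j) ?L = replicate (length (fibre \<alpha> \<pi> j)) j"
      unfolding length_fibre by (simp only: replicate_length_filter)
  qed
  finally show ?thesis .
qed

lemma sorted_concat_replicate: "sorted (concat (map (\<lambda>j. replicate (c j) j) [0..<m]))"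
  by (induction m) (auto simp: sorted_append)

lemma splitting_from_surjection:
  assumes bs: "bs \<in> splittings \<alpha>"
  obtains \<pi> where "\<pi> \<in> mono_surjections (length \<alpha>) (length bs)"
    "map (fibre \<alpha> \<pi>) [0..<length bs] = bs"
proof -
  \<comment> \<open>The blocks of values: every position in the \<open>j\<close>-th block is sent to \<open>j\<close>.\<close>
  define ls where "ls = map (\<lambda>j. replicate (length (bs ! j)) j) [0..<length bs]"
  define \<pi> where "\<pi> = restrict ((!) (concat ls)) {..<length \<alpha>}"
  have \<alpha>: "\<alpha> = concat bs" and ne: "[] \<notin> set bs" using bs by (auto simp: splittings_def)
  have "map length ls = map length bs"
    by (intro nth_equalityI) (auto simp: ls_def)
  then have len: "length (concat ls) = length \<alpha>" by (simp add: \<alpha> length_concat)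
  have vals: "value_list (length \<alpha>) \<pi> = concat ls"
    using len by (intro nth_equalityI) (auto simp: value_list_def \<pi>_def)
  have set: "set (concat ls) = {..<length bs}"
    using ne by (auto simp: ls_def set_replicate_conv_if) (metis nth_mem)
  have "mono_on {..<length \<alpha>} \<pi>"
    using sorted_concat_replicate[of "\<lambda>j. length (bs ! j)" "length bs"] len
    by (auto simp: mono_on_def \<pi>_def ls_def[symmetric] sorted_iff_nth_mono)
  moreover have "\<pi> ` {..<length \<alpha>} = {..<length bs}"
    unfolding set[symmetric] vals[symmetric] by (auto simp: value_list_def)
  moreover have "\<pi> \<in> {..<length \<alpha>} \<rightarrow>\<^sub>E {..<length bs}"
    using calculation(2) by (auto simp: \<pi>_def)
  ultimately have "\<pi> \<in> mono_surjections (length \<alpha>) (length bs)"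
    by (simp add: mono_surjections_def)
  moreover have "map (fibre \<alpha> \<pi>) [0..<length bs] = bs"
  proof (rule nth_equalityI)
    fix j assume "j < length (map (fibre \<alpha> \<pi>) [0..<length bs])"
    then have j: "j < length bs" by simp
    have "fibre \<alpha> \<pi> j = map fst (filter ((\<lambda>k. k = j) \<circ> snd) (zip (concat bs) (concat ls)))"
      by (simp only: fibre_eq_filter_zip vals) (simp add: \<alpha>)
    also have "\<dots> = map fst (filter ((\<lambda>k. k = j) \<circ> snd) (zip (bs ! j) (ls ! j)))"
      using j by (subst filter_zip_concat_block[where i = j]) (auto simp: ls_def)
    also have "filter ((\<lambda>k. k = j) \<circ> snd) (zip (bs ! j) (ls ! j)) = zip (bs ! j) (ls ! j)"
      using j by (auto simp: filter_id_conv ls_def dest: set_zip_rightD)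
    also have "map fst (zip (bs ! j) (ls ! j)) = bs ! j" using j by (simp add: ls_def)
    finally show "map (fibre \<alpha> \<pi>) [0..<length bs] ! j = bs ! j" using j by simp
  qed simp
  ultimately show ?thesis by (rule that)
qed

text \<open>
  The fibre lists of the order-preserving surjections are exactly the splittings: fibres are nonempty by
  surjectivity and consecutive by monotonicity, and numbering the blocks of a splitting gives the
  inverse.
\<close>

lemma plethysm_splittings:
  assumes "\<alpha> \<noteq> []"
  shows "plethysm F G \<alpha> = (\<Sum>bs\<in>splittings \<alpha>. F (map tuple_sum bs) * prod_list (map G bs))"
proof -
  let ?n = "length \<alpha>"
  let ?M = "SIGMA m:{1..?n}. mono_surjections ?n m"
  let ?split = "\<lambda>(m, \<pi>). map (fibre \<alpha> \<pi>) [0..<m]"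
  have fin: "finite (mono_surjections ?n m)" for m
    unfolding mono_surjections_def by (rule finite_subset[OF _ finite_PiE[of "{..<?n}" "\<lambda>_. {..<m}"]]) auto
  have "inj_on ?split ?M"
  proof (rule inj_onI, clarify)
    fix m \<pi> m' \<pi>'
    assume \<pi>: "\<pi> \<in> mono_surjections ?n m" and \<pi>': "\<pi>' \<in> mono_surjections ?n m'"
      and eq: "map (fibre \<alpha> \<pi>) [0..<m] = map (fibre \<alpha> \<pi>') [0..<m']"
    have m: "m' = m" using arg_cong[OF eq, of length] by simp
    have "value_list ?n \<pi> = value_list ?n \<pi>'"
      unfolding value_list_eq_concat_replicate[OF \<pi>] value_list_eq_concat_replicate[OF \<pi>'] using eq m
      by (intro arg_cong[where f = concat]) auto
    then have "\<pi> i = \<pi>' i" if "i < ?n" for i using that by (simp add: value_list_def)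
    then have "\<pi> = \<pi>'"
      using \<pi> \<pi>' by (intro PiE_ext[of _ "{..<?n}" "\<lambda>_. {..<m}"]) (auto simp: mono_surjections_def m)
    then show "m = m' \<and> \<pi> = \<pi>'" using m by simp
  qed
  moreover have "?split ` ?M = splittings \<alpha>"
  proof (intro equalityI subsetI)
    fix bs assume "bs \<in> ?split ` ?M"
    then obtain m \<pi> where \<pi>: "\<pi> \<in> mono_surjections ?n m" and bs: "bs = map (fibre \<alpha> \<pi>) [0..<m]"
      by auto
    have "fibre \<alpha> \<pi> j \<noteq> []" if "j < m" for j
    proof -
      have "j \<in> set (value_list ?n \<pi>)" using that mono_surjections_value_list(2)[OF \<pi>] by simp
      then have "length (fibre \<alpha> \<pi> j) \<noteq> 0" by (auto simp: length_fibre filter_empty_conv)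
      then show ?thesis by auto
    qed
    then show "bs \<in> splittings \<alpha>"
      using concat_fibres[OF \<pi>] by (auto simp: splittings_def bs image_iff) metis
  next
    fix bs assume bs: "bs \<in> splittings \<alpha>"
    obtain \<pi> where \<pi>: "\<pi> \<in> mono_surjections ?n (length bs)" "map (fibre \<alpha> \<pi>) [0..<length bs] = bs"
      using splitting_from_surjection[OF bs] .
    have "1 \<le> length bs" using splittings_nonempty[OF bs assms] by (cases bs) auto
    moreover have "length bs \<le> ?n"
      using bs length_le_length_concat by (auto simp: splittings_def)
    ultimately show "bs \<in> ?split ` ?M" using \<pi> by (intro image_eqI[of _ _ "(length bs, \<pi>)"]) auto
  qed
  ultimately have bij: "bij_betw ?split ?M (splittings \<alpha>)" by (simp add: bij_betw_def)
  have "plethysm F G \<alpha>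
      = (\<Sum>(m, \<pi>)\<in>?M. F (pushforward \<pi> m \<alpha>) * (\<Prod>j<m. G (fibre \<alpha> \<pi> j)))"
    unfolding plethysm_def using fin by (intro sum.Sigma) auto
  also have "\<dots> = (\<Sum>x\<in>?M. F (map tuple_sum (?split x)) * prod_list (map G (?split x)))"
    by (intro sum.cong refl)
      (auto simp: pushforward_def o_def prod.list_conv_set_nth atLeast0LessThan)
  also have "\<dots> = (\<Sum>bs\<in>splittings \<alpha>. F (map tuple_sum bs) * prod_list (map G bs))"
    by (rule sum.reindex_bij_betw[OF bij])
  finally show ?thesis .
qed

section \<open>The plethysm monoid\<close>

lemma tuple_sum_singleton [simp]: "tuple_sum [a] = a"
  by (simp add: tuple_sum_def)

lemma tuple_sum_Cons: "xs \<noteq> [] \<Longrightarrow> tuple_sum (x # xs) = x + tuple_sum xs"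
proof -
  have *: "foldl (+) (a + b) ys = a + foldl (+) b ys" for a b :: 'a and ys
    by (induction ys arbitrary: b) (simp_all add: add.assoc)
  assume "xs \<noteq> []"
  then show ?thesis by (cases xs) (simp_all add: tuple_sum_def *)
qed

lemma tuple_sum_append:
  "xs \<noteq> [] \<Longrightarrow> ys \<noteq> [] \<Longrightarrow> tuple_sum (xs @ ys) = tuple_sum xs + tuple_sum ys"
  by (induction xs rule: list_nonempty_induct) (simp_all add: tuple_sum_Cons add.assoc)

text \<open>
  Summing in two stages agrees with summing at once; the pushforward along a composite of surjections is
  therefore the composite of the pushforwards, as associativity of plethysm requires.
\<close>

lemma tuple_sum_concat:
  "bs \<noteq> [] \<Longrightarrow> [] \<notin> set bs \<Longrightarrow> tuple_sum (concat bs) = tuple_sum (map tuple_sum bs)"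
proof (induction bs rule: list_nonempty_induct)
  case (cons b bs)
  have "concat bs \<noteq> []" "b \<noteq> []" using cons.hyps cons.prems by (cases bs; auto)+
  then show ?case using cons by (simp add: tuple_sum_append tuple_sum_Cons)
qed simp

lemma prod_list_sum_fibres:
  fixes g :: "'e \<Rightarrow> rat"
  assumes "\<And>b. b \<in> set bs \<Longrightarrow> finite {e \<in> E. h e = b}"
  shows "finite {es \<in> lists E. map h es = bs} \<and>
    prod_list (map (\<lambda>b. \<Sum>e\<in>{e \<in> E. h e = b}. g e) bs)
      = (\<Sum>es\<in>{es \<in> lists E. map h es = bs}. prod_list (map g es))"
  using assms
proof (induction bs)
  case Nil
  have "{es \<in> lists E. map h es = []} = {[]}" by auto
  then show ?case by simp
next
  case (Cons b bs)
  let ?A = "{e \<in> E. h e = b}" and ?B = "{es \<in> lists E. map h es = bs}"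
  have A: "finite ?A" and B: "finite ?B" using Cons by auto
  have *: "{es \<in> lists E. map h es = b # bs} = (\<lambda>(e, es). e # es) ` (?A \<times> ?B)"
    by (auto simp: map_eq_Cons_conv image_iff)
  have inj: "inj_on (\<lambda>(e, es). e # es) (?A \<times> ?B)" by (auto simp: inj_on_def)
  have "(\<Sum>e\<in>?A. g e) * (\<Sum>es\<in>?B. prod_list (map g es))
      = (\<Sum>(e, es)\<in>?A \<times> ?B. g e * prod_list (map g es))"
    by (simp add: sum_product sum.cartesian_product)
  also have "\<dots> = (\<Sum>es\<in>{es \<in> lists E. map h es = b # bs}. prod_list (map g es))"
    unfolding * by (subst sum.reindex[OF inj]) (auto intro!: sum.cong)
  finally show ?case using A B Cons unfolding * by simp
qed

text \<open>
  The distributive law behind both the associativity of plethysm and the recursion for trees. In a sum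
  over block lists, expand each factor, itself a sum over the objects \<open>e\<close> lying over its block. As
  \<open>h e\<close> recovers the block from the object, the result is one sum over lists of objects.
\<close>

lemma sum_choices:
  fixes g :: "'e \<Rightarrow> rat"
  assumes "finite A" "\<And>bs b. bs \<in> A \<Longrightarrow> b \<in> set bs \<Longrightarrow> finite {e \<in> E. h e = b}"
  shows "(\<Sum>bs\<in>A. \<Phi> bs * prod_list (map (\<lambda>b. \<Sum>e\<in>{e \<in> E. h e = b}. g e) bs))
    = (\<Sum>es\<in>{es \<in> lists E. map h es \<in> A}. \<Phi> (map h es) * prod_list (map g es))"
proof -
  let ?E = "{es \<in> lists E. map h es \<in> A}"
  have fin: "finite ?E"
  proof -
    have "?E = (\<Union>bs\<in>A. {es \<in> lists E. map h es = bs})" by auto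
    then show ?thesis using assms prod_list_sum_fibres[of _ E h] by auto
  qed
  have "\<Phi> bs * prod_list (map (\<lambda>b. \<Sum>e\<in>{e \<in> E. h e = b}. g e) bs)
      = (\<Sum>es\<in>{es \<in> ?E. map h es = bs}. \<Phi> (map h es) * prod_list (map g es))"
    if "bs \<in> A" for bs
  proof -
    have "{es \<in> ?E. map h es = bs} = {es \<in> lists E. map h es = bs}" using that by auto
    then show ?thesis
      using prod_list_sum_fibres[of bs E h g] assms(2)[OF that] by (simp add: sum_distrib_left)
  qed
  then have "(\<Sum>bs\<in>A. \<Phi> bs * prod_list (map (\<lambda>b. \<Sum>e\<in>{e \<in> E. h e = b}. g e) bs))
      = (\<Sum>bs\<in>A. \<Sum>es\<in>{es \<in> ?E. map h es = bs}. \<Phi> (map h es) * prod_list (map g es))"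
    by (rule sum.cong[OF refl])
  also have "\<dots> = (\<Sum>es\<in>?E. \<Phi> (map h es) * prod_list (map g es))"
    using fin assms(1) by (intro sum.group) auto
  finally show ?thesis .
qed

lemma plethysm_cong:
  assumes "eq_collection F F'" "eq_collection G G'"
  shows "eq_collection (plethysm F G) (plethysm F' G')"
  unfolding eq_collection_def
proof (intro allI impI)
  fix \<alpha> :: "'a list" assume \<alpha>: "\<alpha> \<noteq> []"
  have "F (map tuple_sum bs) * prod_list (map G bs) = F' (map tuple_sum bs) * prod_list (map G' bs)"
    if bs: "bs \<in> splittings \<alpha>" for bs
  proof -
    have "G b = G' b" if "b \<in> set bs" for b
    proof -
      have "b \<noteq> []" using bs that by (auto simp: splittings_def)
      then show ?thesis using assms(2) by (simp add: eq_collection_def)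
    qed
    then have "map G bs = map G' bs" by (rule map_cong[OF refl])
    moreover have "F (map tuple_sum bs) = F' (map tuple_sum bs)"
      using assms(1) splittings_nonempty[OF bs \<alpha>] by (simp add: eq_collection_def)
    ultimately show ?thesis by (simp only:)
  qed
  then show "plethysm F G \<alpha> = plethysm F' G' \<alpha>"
    unfolding plethysm_splittings[OF \<alpha>] by (rule sum.cong[OF refl])
qed

lemma plethysm_id_left: "eq_collection (plethysm id_collection G) G"
  unfolding eq_collection_def
proof (intro allI impI)
  fix \<alpha> :: "'a list" assume \<alpha>: "\<alpha> \<noteq> []"
  have "plethysm id_collection G \<alpha>
      = (\<Sum>bs\<in>{[\<alpha>]}. id_collection (map tuple_sum bs) * prod_list (map G bs))"
    unfolding plethysm_splittings[OF \<alpha>]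
    using \<alpha> by (intro sum.mono_neutral_right finite_splittings)
      (auto simp: splittings_def id_collection_def length_Suc_conv)
  then show "plethysm id_collection G \<alpha> = G \<alpha>" by (simp add: id_collection_def)
qed

lemma plethysm_id_right: "eq_collection (plethysm F id_collection) F"
  unfolding eq_collection_def
proof (intro allI impI)
  fix \<alpha> :: "'a list" assume \<alpha>: "\<alpha> \<noteq> []"
  let ?s = "map (\<lambda>a. [a]) \<alpha>"
  have "prod_list (map id_collection bs) = 0" if "bs \<in> splittings \<alpha> - {?s}" for bs
  proof (rule ccontr)
    assume "prod_list (map id_collection bs) \<noteq> 0"
    then have "\<forall>b\<in>set bs. length b = 1"
      by (auto simp: prod_list_zero_iff id_collection_def split: if_splits)
    then have "bs = map (\<lambda>a. [a]) (concat bs)"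
      by (induction bs) (auto simp: length_Suc_conv)
    then show False using that by (simp add: splittings_def)
  qed
  then have "plethysm F id_collection \<alpha>
      = (\<Sum>bs\<in>{?s}. F (map tuple_sum bs) * prod_list (map id_collection bs))"
    unfolding plethysm_splittings[OF \<alpha>]
    by (intro sum.mono_neutral_right finite_splittings) (auto simp: splittings_def concat_map_singleton)
  then show "plethysm F id_collection \<alpha> = F \<alpha>"
    by (simp add: o_def id_collection_def prod.list_conv_set_nth)
qed

text \<open>
  Mapping preserves the lengths of the blocks, and a list can be cut in only one way into blocks of
  given lengths.
\<close>

lemma bij_splittings_map: "bij_betw (map (map f)) (splittings bs) (splittings (map f bs))"
proof (rule bij_betw_imageI)
  show "inj_on (map (map f)) (splittings bs)"
  proof (rule inj_onI)
    fix X Y assume XY: "X \<in> splittings bs" "Y \<in> splittings bs" "map (map f) X = map (map f) Y"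
    have "length X = length Y" using XY(3) by (rule map_eq_imp_length_eq)
    moreover have "length (X ! i) = length (Y ! i)" if "i < length X" for i
      using arg_cong[OF XY(3), of "\<lambda>Z. length (Z ! i)"] that calculation by simp
    ultimately show "X = Y"
      using XY(1,2) by (intro concat_injective) (auto simp: splittings_def set_zip)
  qed
  have "\<exists>X. concat X = bs \<and> map (map f) X = cs" if "concat cs = map f bs" for cs
    using that
  proof (induction cs arbitrary: bs)
    case (Cons c cs)
    then obtain us vs where "bs = us @ vs" "map f us = c" "map f vs = concat cs"
      by (metis concat.simps(2) map_eq_append_conv)
    moreover obtain X where "concat X = vs" "map (map f) X = cs"
      using Cons.IH[of vs] calculation by metis
    ultimately show ?case by (intro exI[of _ "us # X"]) simp
  qed simp
  then show "map (map f) ` splittings bs = splittings (map f bs)"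
    by (force simp: splittings_def map_concat)
qed

lemma concat_map_concat: "concat (map concat X) = concat (concat X)"
  by (induction X) simp_all

text \<open>
  Both sides are sums over twofold splittings of \<open>\<alpha>\<close>, that is, lists \<open>X\<close> of nonempty lists of nonempty
  blocks whose total concatenation is \<open>\<alpha>\<close>. Cutting into the fine blocks \<open>concat X\<close> first and grouping
  them gives \<open>(F \<circ> G) \<circ> H\<close>; cutting into the coarse blocks \<open>map concat X\<close> first and refining them
  gives \<open>F \<circ> (G \<circ> H)\<close>.
\<close>

lemma plethysm_assoc:
  "eq_collection (plethysm (plethysm F G) H) (plethysm F (plethysm G H))"
  unfolding eq_collection_def
proof (intro allI impI)
  fix \<alpha> :: "'a list" assume \<alpha>: "\<alpha> \<noteq> []"
  let ?E = "{x :: 'a list list. x \<noteq> [] \<and> [] \<notin> set x}"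
  let ?w = "\<lambda>x. G (map tuple_sum x) * prod_list (map H x)"
  let ?\<Phi> = "\<lambda>ds. F (map tuple_sum ds)"
  let ?t = "\<lambda>X. F (map (tuple_sum \<circ> map tuple_sum) X) * prod_list (map (G \<circ> map tuple_sum) X)
      * prod_list (map H (concat X))"
  let ?U = "{X \<in> lists ?E. concat (concat X) = \<alpha>}"
  have E: "{x \<in> ?E. concat x = d} = splittings d" if "d \<noteq> []" for d
    using that by (auto simp: splittings_def)
  have U: "?U = {X \<in> lists ?E. map concat X \<in> splittings \<alpha>}"
  proof -
    have "[] \<notin> set (map concat X)" if "X \<in> lists ?E" for X
    proof
      assume "[] \<in> set (map concat X)"
      then obtain x where "x \<in> set X" "concat x = []" by auto
      moreover have "x \<noteq> []" "[] \<notin> set x" using calculation(1) that by auto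
      ultimately show False by (metis concat_eq_Nil_conv list.set_sel(1))
    qed
    then show ?thesis by (intro Collect_cong) (auto simp: splittings_def concat_map_concat)
  qed
  have mass: "map tuple_sum (map concat X) = map (\<lambda>x. tuple_sum (map tuple_sum x)) X" if "X \<in> lists ?E" for X
    using that by (auto intro!: tuple_sum_concat)

  have "plethysm F (plethysm G H) \<alpha>
      = (\<Sum>ds\<in>splittings \<alpha>. ?\<Phi> ds * prod_list (map (\<lambda>d. \<Sum>x\<in>{x \<in> ?E. concat x = d}. ?w x) ds))"
    unfolding plethysm_splittings[OF \<alpha>]
  proof (intro sum.cong refl)
    fix ds assume "ds \<in> splittings \<alpha>"
    have "plethysm G H d = (\<Sum>x\<in>{x \<in> ?E. concat x = d}. ?w x)" if "d \<in> set ds" for d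
    proof -
      have d: "d \<noteq> []" using that \<open>ds \<in> splittings \<alpha>\<close> by (auto simp: splittings_def)
      show ?thesis unfolding E[OF d] by (rule plethysm_splittings[OF d])
    qed
    then have "map (plethysm G H) ds = map (\<lambda>d. \<Sum>x\<in>{x \<in> ?E. concat x = d}. ?w x) ds"
      by (rule map_cong[OF refl])
    then show "?\<Phi> ds * prod_list (map (plethysm G H) ds)
        = ?\<Phi> ds * prod_list (map (\<lambda>d. \<Sum>x\<in>{x \<in> ?E. concat x = d}. ?w x) ds)"
      by (simp only:)
  qed
  also have "\<dots> = (\<Sum>X\<in>?U. ?\<Phi> (map concat X) * prod_list (map ?w X))"
    unfolding U
  proof (rule sum_choices[OF finite_splittings])
    fix ds d assume "ds \<in> splittings \<alpha>" "d \<in> set ds"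
    then have "d \<noteq> []" by (auto simp: splittings_def)
    then show "finite {x \<in> ?E. concat x = d}" using finite_splittings[of d] E by simp
  qed
  also have "\<dots> = (\<Sum>X\<in>?U. ?t X)"
  proof (intro sum.cong refl)
    fix X assume "X \<in> ?U"
    then have "?\<Phi> (map concat X) = F (map (tuple_sum \<circ> map tuple_sum) X)"
      by (simp only: mass o_def mem_Collect_eq)
    moreover have "prod_list (map ?w X) = prod_list (map (G \<circ> map tuple_sum) X) * prod_list (map H (concat X))"
      by (induction X) simp_all
    ultimately show "?\<Phi> (map concat X) * prod_list (map ?w X)
        = ?t X"
      by (simp only: mult.assoc)
  qed
  finally have right: "plethysm F (plethysm G H) \<alpha> = \<dots>" .

  have "plethysm (plethysm F G) H \<alpha> = (\<Sum>bs\<in>splittings \<alpha>. \<Sum>X\<in>splittings bs.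
      ?t X)"
    unfolding plethysm_splittings[OF \<alpha>]
  proof (intro sum.cong refl)
    fix bs assume bs: "bs \<in> splittings \<alpha>"
    then have ne: "map tuple_sum bs \<noteq> []" using splittings_nonempty[OF bs \<alpha>] by simp
    have "plethysm F G (map tuple_sum bs) = (\<Sum>X\<in>splittings bs.
        F (map tuple_sum (map (map tuple_sum) X)) * prod_list (map G (map (map tuple_sum) X)))"
      unfolding plethysm_splittings[OF ne]
      by (rule sum.reindex_bij_betw[OF bij_splittings_map, symmetric])
    then show "plethysm F G (map tuple_sum bs) * prod_list (map H bs) = (\<Sum>X\<in>splittings bs.
      ?t X)"
      by (auto simp: sum_distrib_right splittings_def intro!: sum.cong)
  qed
  also have "\<dots> = (\<Sum>X\<in>?U. ?t X)"
  proof -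
    have eq: "splittings bs = {X \<in> ?U. concat X = bs}" if "bs \<in> splittings \<alpha>" for bs
      using that by (fastforce simp: splittings_def)
    have "?U = (\<Union>bs\<in>splittings \<alpha>. splittings bs)"
      by (fastforce simp: splittings_def)
    then have "finite ?U" by (simp only: finite_UN_I[OF finite_splittings finite_splittings])
    moreover have "concat ` ?U \<subseteq> splittings \<alpha>" by (auto simp: splittings_def)
    moreover have "(\<Sum>bs\<in>splittings \<alpha>. \<Sum>X\<in>splittings bs. \<phi> X)
        = (\<Sum>bs\<in>splittings \<alpha>. \<Sum>X\<in>{X \<in> ?U. concat X = bs}. \<phi> X)" for \<phi> :: "'a list list list \<Rightarrow> rat"
      by (intro sum.cong eq refl)
    ultimately show ?thesis by (simp only: sum.group[OF _ finite_splittings])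
  qed
  finally show "plethysm (plethysm F G) H \<alpha> = plethysm F (plethysm G H) \<alpha>"
    unfolding right .
qed

section \<open>Decomposition of a tree at its root\<close>

lemma internal_Vertex:
  "ts \<noteq> [] \<Longrightarrow> internal (Vertex ts) = insert [] (\<Union>i<length ts. (#) i ` internal (ts ! i))"
  by (auto simp: internal_def)

lemma length_leaves_Vertex_sum_list:
  "ts \<noteq> [] \<Longrightarrow> length (leaves (Vertex ts)) = sum_list (map (length \<circ> leaves) ts)"
  by (simp add: length_leaves_Vertex sum_list_sum_nth atLeast0LessThan del: leaves.simps)

lemma vertex_sum_eq_filter_zip:
  assumes "length \<alpha> = length (leaves T)"
  shows "vertex_sum \<alpha> T u = tuple_sum (map fst (filter (prefix u \<circ> snd) (zip \<alpha> (leaves T))))"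
  unfolding vertex_sum_def using nths_eq_filter_zip[of "leaves T" \<alpha> "prefix u"] assms by simp

lemma vertex_sum_root: "length \<alpha> = length (leaves T) \<Longrightarrow> vertex_sum \<alpha> T [] = tuple_sum \<alpha>"
  by (simp add: vertex_sum_eq_filter_zip o_def)

text \<open>
  The leaves below a vertex of the \<open>i\<close>-th branch lie in that branch, so only the block of \<open>\<alpha>\<close> attached to
  this branch contributes to the label of the vertex.
\<close>

lemma vertex_sum_Cons:
  assumes len: "map length bs = map (length \<circ> leaves) ts" and i: "i < length ts"
  shows "vertex_sum (concat bs) (Vertex ts) (i # u) = vertex_sum (bs ! i) (ts ! i) u"
proof -
  define ls where "ls = map (\<lambda>i. map ((#) i) (leaves (ts ! i))) [0..<length ts]"
  have ts: "ts \<noteq> []" using i by auto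
  have bs: "length bs = length ts" using len by (rule map_eq_imp_length_eq)
  have bl: "length (bs ! j) = length (leaves (ts ! j))" if "j < length ts" for j
    using arg_cong[OF len, of "\<lambda>xs. xs ! j"] that bs by simp
  have leaves: "leaves (Vertex ts) = concat ls" using ts by (simp add: ls_def)
  have "length (concat bs) = length (leaves (Vertex ts))"
    unfolding length_leaves_Vertex_sum_list[OF ts] length_concat len ..
  then have "vertex_sum (concat bs) (Vertex ts) (i # u)
      = tuple_sum (map fst (filter (prefix (i # u) \<circ> snd) (zip (concat bs) (concat ls))))"
    by (simp only: vertex_sum_eq_filter_zip leaves)
  also have "filter (prefix (i # u) \<circ> snd) (zip (concat bs) (concat ls))
      = filter (prefix (i # u) \<circ> snd) (zip (bs ! i) (ls ! i))"
    using bs bl i by (intro filter_zip_concat_block) (auto simp: ls_def)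
  also have "map fst \<dots> = map fst (filter (prefix u \<circ> snd) (zip (bs ! i) (leaves (ts ! i))))"
    using i by (simp add: ls_def zip_map2 filter_map o_def case_prod_unfold)
  also have "tuple_sum \<dots> = vertex_sum (bs ! i) (ts ! i) u"
    using bl[OF i] by (simp add: vertex_sum_eq_filter_zip)
  finally show ?thesis .
qed

lemma tree_weight_leaf: "tree_weight F \<alpha> (Vertex []) = 1"
proof -
  have "internal (Vertex []) = {}" by (auto simp: internal_def)
  then show ?thesis by (simp add: tree_weight_def)
qed

text \<open>
  Cutting off the root: the internal vertices are the root and those of the branches, the children of the
  root are labelled by the sums of the blocks, and the labels inside a branch depend on its block only.
\<close>

lemma tree_weight_Vertex:
  assumes len: "map length bs = map (length \<circ> leaves) ts" and ts: "ts \<noteq> []"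
  shows "tree_weight F (concat bs) (Vertex ts)
    = F (map tuple_sum bs) * prod_list (map (\<lambda>(b, t). tree_weight F b t) (zip bs ts))"
proof -
  let ?T = "Vertex ts" and ?\<alpha> = "concat bs"
  let ?f = "\<lambda>v. F (map (vertex_sum ?\<alpha> ?T) (ch ?T v))"
  have bs: "length bs = length ts" using len by (rule map_eq_imp_length_eq)
  have bl: "length (bs ! j) = length (leaves (ts ! j))" if "j < length ts" for j
    using arg_cong[OF len, of "\<lambda>xs. xs ! j"] that bs by simp
  \<comment> \<open>The label of a child of the root is the sum over the whole block of its branch.\<close>
  have root: "?f [] = F (map tuple_sum bs)"
  proof -
    have "map (vertex_sum ?\<alpha> ?T) (ch ?T []) = map tuple_sum bs"
      using bs bl by (intro nth_equalityI) (auto simp: ch_def vertex_sum_Cons[OF len] vertex_sum_root)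
    then show ?thesis by simp
  qed
  have branch: "(\<Prod>v\<in>(#) i ` internal (ts ! i). ?f v) = tree_weight F (bs ! i) (ts ! i)"
    if i: "i < length ts" for i
  proof -
    have "ch ?T (i # u) = map ((#) i) (ch (ts ! i) u)" for u
      using i by (simp add: ch_def)
    then show ?thesis
      unfolding tree_weight_def using vertex_sum_Cons[OF len i]
      by (subst prod.reindex) (simp_all add: o_def)
  qed
  have "tree_weight F ?\<alpha> ?T = ?f [] * (\<Prod>v\<in>(\<Union>i<length ts. (#) i ` internal (ts ! i)). ?f v)"
    unfolding tree_weight_def internal_Vertex[OF ts]
    by (subst prod.insert) (auto simp: finite_internal)
  also have "(\<Prod>v\<in>(\<Union>i<length ts. (#) i ` internal (ts ! i)). ?f v)
      = (\<Prod>i<length ts. \<Prod>v\<in>(#) i ` internal (ts ! i). ?f v)"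
    by (intro prod.UNION_disjoint) (auto simp: finite_internal)
  also have "\<dots> = (\<Prod>i<length ts. tree_weight F (bs ! i) (ts ! i))"
    by (intro prod.cong refl branch) simp
  also have "\<dots> = prod_list (map (\<lambda>(b, t). tree_weight F b t) (zip bs ts))"
    using bs by (simp add: prod.list_conv_set_nth atLeast0LessThan)
  finally show ?thesis unfolding root .
qed

text \<open>
  The trees with unary vertices have weight zero for every \<open>F\<close> supported in cardinality at least \<open>2\<close>.
  Discarding them gives a finite index set that depends on the number of leaves only, unlike the set
  of trees of nonzero weight.
\<close>

definition reduced_trees :: "nat \<Rightarrow> plane_tree set" where
  "reduced_trees n = {T \<in> trees n. no_unary T}"

lemma tree_collection_reduced:
  assumes "supported_ge2 F"
  shows "tree_collection F \<alpha> = (\<Sum>T\<in>reduced_trees (length \<alpha>). tree_weight F \<alpha> T)"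
  unfolding tree_collection_def reduced_trees_def
  by (rule sum.mono_neutral_left[OF finite_no_unary]) (use tree_weight_unary[OF assms] in auto)

lemma exists_blocks_of_lengths:
  "sum_list ns = length \<alpha> \<Longrightarrow> \<exists>bs. concat bs = \<alpha> \<and> map length bs = ns"
proof (induction ns arbitrary: \<alpha>)
  case (Cons k ns)
  have "sum_list ns = length (drop k \<alpha>)" using Cons.prems[symmetric] by simp
  then obtain bs where "concat bs = drop k \<alpha>" "map length bs = ns" using Cons.IH by blast
  then show ?case using Cons.prems by (intro exI[of _ "take k \<alpha> # bs"]) auto
qed simp

text \<open>
  A reduced tree other than the unit tree is the list of its branches. The leaf counts of the branches
  determine the blocks of \<open>\<alpha>\<close> on which they sit, so the branches may be stored paired with their
  blocks. A root with one child is excluded, hence \<open>length bs \<noteq> 1\<close>.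
\<close>

lemma bij_root_decomposition:
  assumes \<alpha>: "\<alpha> \<noteq> []"
  shows "bij_betw (\<lambda>es. Vertex (map snd es))
    {es \<in> lists {(b, t). t \<in> reduced_trees (length b)}.
      map fst es \<in> {bs \<in> splittings \<alpha>. length bs \<noteq> 1}}
    (reduced_trees (length \<alpha>) - {Vertex []})"
    (is "bij_betw ?v ?ES ?R")
proof (rule bij_betw_imageI)
  have len: "map length (map fst es) = map (length \<circ> leaves) (map snd es)" if "es \<in> ?ES" for es
    using that by (auto simp: reduced_trees_def trees_def)
  show "inj_on ?v ?ES"
  proof (rule inj_onI)
    fix es es' assume es: "es \<in> ?ES" "es' \<in> ?ES" and "?v es = ?v es'"
    then have snd: "map snd es = map snd es'" by simp
    have lens: "map length (map fst es) = map length (map fst es')"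
      unfolding len[OF es(1)] len[OF es(2)] snd ..
    have "map fst es = map fst es'"
    proof (rule concat_injective)
      show "concat (map fst es) = concat (map fst es')" using es by (simp add: splittings_def)
      show l: "length (map fst es) = length (map fst es')" using lens by (rule map_eq_imp_length_eq)
      have "length (map fst es ! i) = length (map fst es' ! i)" if "i < length es" for i
        using arg_cong[OF lens, of "\<lambda>xs. xs ! i"] that l by simp
      then show "\<forall>(x, y)\<in>set (zip (map fst es) (map fst es')). length x = length y"
        by (auto simp: set_zip)
    qed
    with snd show "es = es'" by (metis zip_map_fst_snd)
  qed
  show "?v ` ?ES = ?R"
  proof (intro equalityI subsetI)
    fix T assume "T \<in> ?v ` ?ES"
    then obtain es where es: "es \<in> ?ES" and T: "T = ?v es" by blast
    have ne: "map snd es \<noteq> []" using es \<alpha> splittings_nonempty[of "map fst es" \<alpha>] by auto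
    have "length (leaves T) = length (concat (map fst es))"
      unfolding T length_leaves_Vertex_sum_list[OF ne] len[OF es, symmetric] length_concat ..
    moreover have "no_unary T" using es by (auto simp: T no_unary_Vertex reduced_trees_def)
    ultimately show "T \<in> ?R"
      using es ne by (simp add: reduced_trees_def trees_def splittings_def T)
  next
    fix T assume T: "T \<in> ?R"
    obtain ts where ts: "T = Vertex ts" by (cases T)
    have ne: "ts \<noteq> []" using T ts by auto
    have "sum_list (map (length \<circ> leaves) ts) = length \<alpha>"
      using T unfolding length_leaves_Vertex_sum_list[OF ne, symmetric]
      by (simp add: ts reduced_trees_def trees_def del: leaves.simps)
    then obtain bs where bs: "concat bs = \<alpha>" "map length bs = map (length \<circ> leaves) ts"
      using exists_blocks_of_lengths by blast
    have l: "length bs = length ts" using bs(2) by (rule map_eq_imp_length_eq)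
    have bl: "length (bs ! j) = length (leaves (ts ! j))" if "j < length ts" for j
      using arg_cong[OF bs(2), of "\<lambda>xs. xs ! j"] that l by simp
    have nu: "length ts \<noteq> 1" "\<forall>t\<in>set ts. no_unary t"
      using T by (simp_all add: ts reduced_trees_def no_unary_Vertex)
    have "[] \<notin> set bs"
    proof
      assume "[] \<in> set bs"
      then obtain j where "j < length ts" "bs ! j = []" using l by (auto simp: in_set_conv_nth)
      then show False using bl[of j] length_leaves_pos[of "ts ! j"] by simp
    qed
    then have "map fst (zip bs ts) \<in> {bs \<in> splittings \<alpha>. length bs \<noteq> 1}"
      using bs(1) nu(1) l by (simp add: splittings_def)
    moreover have "zip bs ts \<in> lists {(b, t). t \<in> reduced_trees (length b)}"
    proof (rule in_listsI, rule ballI)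
      fix e assume "e \<in> set (zip bs ts)"
      then obtain j where j: "j < length ts" "e = (bs ! j, ts ! j)" by (auto simp: set_zip)
      then show "e \<in> {(b, t). t \<in> reduced_trees (length b)}"
        using bl[OF j(1)] nu(2) by (simp add: reduced_trees_def trees_def)
    qed
    ultimately have "zip bs ts \<in> ?ES" by simp
    moreover have "T = ?v (zip bs ts)" using l by (simp add: ts)
    ultimately show "T \<in> ?v ` ?ES" by blast
  qed
qed

text \<open>
  The unit tree contributes the identity collection. The trees with internal root are, by
  \<open>bij_root_decomposition\<close> and \<open>tree_weight_Vertex\<close>, a splitting of \<open>\<alpha>\<close> together with a tree over each
  block, which is what \<open>F \<circ> TF\<close> sums over. Splittings into one block correspond to unary roots and are
  killed by \<open>F\<close>.
\<close>

lemma tree_collection_fixpoint: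
  assumes F: "supported_ge2 F" and \<alpha>: "\<alpha> \<noteq> []"
  shows "tree_collection F \<alpha> = id_collection \<alpha> + plethysm F (tree_collection F) \<alpha>"
proof -
  let ?E = "{(b :: 'a list, t). t \<in> reduced_trees (length b)}"
  let ?A = "{bs \<in> splittings \<alpha>. length bs \<noteq> 1}"
  let ?w = "\<lambda>(b, t). tree_weight F b t"
  let ?ES = "{es \<in> lists ?E. map fst es \<in> ?A}"
  let ?\<Phi> = "\<lambda>bs. F (map tuple_sum bs)"
  have fin: "finite (reduced_trees n)" for n
    unfolding reduced_trees_def by (rule finite_no_unary)
  have fibre: "{e \<in> ?E. fst e = b} = Pair b ` reduced_trees (length b)" for b
    by auto
  have TF: "tree_collection F b = (\<Sum>e\<in>{e \<in> ?E. fst e = b}. ?w e)" for b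
    unfolding fibre tree_collection_reduced[OF F]
    by (subst sum.reindex) (auto simp: inj_on_def)
  have "plethysm F (tree_collection F) \<alpha>
      = (\<Sum>bs\<in>?A. ?\<Phi> bs * prod_list (map (tree_collection F) bs))"
    unfolding plethysm_splittings[OF \<alpha>]
    using F by (intro sum.mono_neutral_right finite_splittings)
      (auto simp: supported_ge2_def length_Suc_conv)
  also have "\<dots> = (\<Sum>bs\<in>?A. ?\<Phi> bs * prod_list (map (\<lambda>b. \<Sum>e\<in>{e \<in> ?E. fst e = b}. ?w e) bs))"
    by (simp only: TF[abs_def])
  also have "\<dots> = (\<Sum>es\<in>?ES. ?\<Phi> (map fst es) * prod_list (map ?w es))"
    by (rule sum_choices) (simp_all only: fibre finite_imageI fin finite_Collect_conjI finite_splittings disjI1 Collect_mem_eq)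
  also have "\<dots> = (\<Sum>es\<in>?ES. tree_weight F \<alpha> (Vertex (map snd es)))"
  proof (intro sum.cong refl)
    fix es assume es: "es \<in> ?ES"
    have "map length (map fst es) = map (length \<circ> leaves) (map snd es)"
      using es by (auto simp: reduced_trees_def trees_def)
    moreover have "map snd es \<noteq> []" using es \<alpha> splittings_nonempty[of "map fst es" \<alpha>] by auto
    ultimately have "tree_weight F (concat (map fst es)) (Vertex (map snd es))
        = ?\<Phi> (map fst es) * prod_list (map ?w (zip (map fst es) (map snd es)))"
      by (rule tree_weight_Vertex)
    moreover have "concat (map fst es) = \<alpha>" using es by (simp add: splittings_def)
    ultimately show "?\<Phi> (map fst es) * prod_list (map ?w es) = tree_weight F \<alpha> (Vertex (map snd es))"
      by (simp only: zip_map_fst_snd)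
  qed
  also have "\<dots> = (\<Sum>T\<in>reduced_trees (length \<alpha>) - {Vertex []}. tree_weight F \<alpha> T)"
    by (rule sum.reindex_bij_betw[OF bij_root_decomposition[OF \<alpha>]])
  finally have rest: "plethysm F (tree_collection F) \<alpha> = \<dots>" .
  show ?thesis
  proof (cases "length \<alpha> = 1")
    case True
    then have "Vertex [] \<in> reduced_trees (length \<alpha>)"
      by (simp add: reduced_trees_def trees_def no_unary_Vertex)
    then show ?thesis
      unfolding rest tree_collection_reduced[OF F]
      using True by (simp add: sum.remove[OF fin] tree_weight_leaf id_collection_def)
  next
    case False
    then have "Vertex [] \<notin> reduced_trees (length \<alpha>)"
      by (simp add: reduced_trees_def trees_def)
    then show ?thesis
      unfolding rest tree_collection_reduced[OF F] using False by (simp add: id_collection_def)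
  qed
qed

section \<open>The two inverse laws\<close>

lemma tree_collection_right_inverse:
  assumes "supported_ge2 F"
  shows "eq_collection (plethysm (id_collection - F) (tree_collection F)) id_collection"
  unfolding eq_collection_def
proof (intro allI impI)
  fix \<alpha> :: "'a list" assume \<alpha>: "\<alpha> \<noteq> []"
  have "plethysm (id_collection - F) (tree_collection F) \<alpha>
      = plethysm id_collection (tree_collection F) \<alpha> - plethysm F (tree_collection F) \<alpha>"
    unfolding plethysm_splittings[OF \<alpha>] by (simp add: left_diff_distrib sum_subtractf)
  also have "plethysm id_collection (tree_collection F) \<alpha> = tree_collection F \<alpha>"
    using plethysm_id_left[of "tree_collection F"] \<alpha> by (simp add: eq_collection_def)
  also have "tree_collection F \<alpha> - plethysm F (tree_collection F) \<alpha> = id_collection \<alpha>"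
    using tree_collection_fixpoint[OF assms \<alpha>] by simp
  finally show "plethysm (id_collection - F) (tree_collection F) \<alpha> = id_collection \<alpha>" .
qed

text \<open>
  This makes \<open>1 - TF\<close> supported in cardinality at least \<open>2\<close>, so that the tree construction applies to it.
\<close>

lemma tree_collection_singleton:
  assumes "supported_ge2 F"
  shows "tree_collection F [a] = 1"
proof -
  have "F (map tuple_sum bs) = 0" if bs: "bs \<in> splittings [a]" for bs
  proof -
    have "length bs \<le> 1" using bs length_le_length_concat[of bs] by (auto simp: splittings_def)
    then obtain b where "bs = [b]"
      using splittings_nonempty[OF bs] by (cases bs) auto
    then show ?thesis using assms by (simp add: supported_ge2_def)
  qed
  then have "plethysm F (tree_collection F) [a] = 0"
    by (subst plethysm_splittings) auto
  then show ?thesis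
    using tree_collection_fixpoint[OF assms, of "[a]"] by (simp add: id_collection_def)
qed

text \<open>
  Put \<open>A = 1 - F\<close> and \<open>B = TF\<close>, so \<open>A \<circ> B = 1\<close>. As \<open>B\<close> is again of the form \<open>1 - F'\<close>, it has a right inverse
  \<open>C = TF'\<close>. In a monoid this forces \<open>A = A \<circ> (B \<circ> C) = (A \<circ> B) \<circ> C = C\<close>, hence \<open>B \<circ> A = 1\<close>.
\<close>

lemma tree_collection_left_inverse:
  assumes F: "supported_ge2 F"
  shows "eq_collection (plethysm (tree_collection F) (id_collection - F)) id_collection"
proof -
  let ?A = "id_collection - F" and ?B = "tree_collection F"
  let ?F' = "id_collection - ?B"
  let ?C = "tree_collection ?F'"
  have "supported_ge2 ?F'"
    using tree_collection_singleton[OF F] by (simp add: supported_ge2_def id_collection_def)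
  then have BC: "eq_collection (plethysm ?B ?C) id_collection"
    using tree_collection_right_inverse[of ?F'] by (simp add: fun_diff_def)
  have refl: "eq_collection G G" for G :: "'a collection" by (simp add: eq_collection_def)
  have trans [trans]: "eq_collection G K" if "eq_collection G H" "eq_collection H K"
    for G H K :: "'a collection" using that by (simp add: eq_collection_def)
  have sym: "eq_collection H G" if "eq_collection G H"
    for G H :: "'a collection" using that by (simp add: eq_collection_def)
  have "eq_collection ?A (plethysm ?A id_collection)"
    by (rule sym[OF plethysm_id_right])
  also have "eq_collection \<dots> (plethysm ?A (plethysm ?B ?C))"
    by (rule plethysm_cong[OF refl sym[OF BC]])
  also have "eq_collection \<dots> (plethysm (plethysm ?A ?B) ?C)"
    by (rule sym[OF plethysm_assoc])
  also have "eq_collection \<dots> (plethysm id_collection ?C)"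
    by (rule plethysm_cong[OF tree_collection_right_inverse[OF F] refl])
  also have "eq_collection \<dots> ?C" by (rule plethysm_id_left)
  finally have AC: "eq_collection ?A ?C" .
  have "eq_collection (plethysm ?B ?A) (plethysm ?B ?C)"
    by (rule plethysm_cong[OF refl AC])
  also have "eq_collection \<dots> id_collection" by (rule BC)
  finally show ?thesis .
qed

theorem theorem2p9:
  fixes F :: "'a::ab_semigroup_add collection"
  assumes "\<And>s :: 'a. finite {\<alpha>. \<alpha> \<noteq> [] \<and> tuple_sum \<alpha> = s}"
    and "supported_ge2 F"
  shows "eq_collection (plethysm (id_collection - F) (tree_collection F)) id_collection
       \<and> eq_collection (plethysm (tree_collection F) (id_collection - F)) id_collection"
  using tree_collection_right_inverse[OF assms(2)] tree_collection_left_inverse[OF assms(2)] ..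

end
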